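(* Let $k\ge 2$, $c$ and $n$ be integers with $n\ge 1$. Let $f(x)=(a_1x-a_2)(b_1x-b_2)$ with $a_1,a_2,b_1,b_2\in\mathbb{Z}$ and $\gcd(a_1,n)=\gcd(b_1,n)=\gcd(a_1b_2-a_2b_1,n)=1$. Then $$\mathcal{N}_{k,f,c}(n)=(-1)^{k\omega(n)}\prod_{p\mid n}p^{k\nu_p(n)-\nu_p(n)-k}\Big(p\sum_{\substack{j=0\\ (a_2b_1-a_1b_2)j\equiv a_1b_1c-a_1b_2k \pmod p}}^{k}\binom{k}{j}+(2-p)^k-2^k\Big),$$ where the product runs over the distinct prime divisors $p$ of $n$.
   Context: For a positive integer $n$, $\mathbb{Z}_n=\{0,1,\dots,n-1\}$ denotes the ring of residue classes modulo $n$. For $f(x)\in\mathbb{Z}[x]$, let $E_f(n)=\{a\in\mathbb{Z}_n:\gcd(f(a),n)=1\}$ (the $f$-exunits in $\mathbb{Z}_n$), and $$\mathcal{N}_{k,f,c}(n)=\#\{(x_1,\dots,x_k)\in E_f(n)^k: x_1+\cdots+x_k\equiv c\pmod n\}.$$ For a prime $p$ and integer $m\neq 0$, $\nu_p(m)$ is the $p$-adic valuation of $m$, and $\omega(n)$ is the number of distinct prime divisors of $n$. *)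

theory Defs
  imports "HOL-Number_Theory.Number_Theory" "HOL-Computational_Algebra.Computational_Algebra"
    "HOL-Library.FuncSet"
begin

text \<open>The residue ring modulo \<open>n\<close> is represented by the integers \<open>{0..<n}\<close>; whether the value of an
  integer polynomial is coprime to \<open>n\<close> does not depend on the chosen representatives.\<close>

definition exunits :: "int poly \<Rightarrow> nat \<Rightarrow> int set" where
  "exunits f n = {a \<in> {0..<int n}. gcd (poly f a) (int n) = 1}"

text \<open>A \<open>k\<close>-tuple \<open>(x\<^sub>1, \<dots>, x\<^sub>k)\<close> is an extensional function on \<open>{1..k}\<close>.\<close>

definition num_exunit_sums :: "nat \<Rightarrow> int poly \<Rightarrow> int \<Rightarrow> nat \<Rightarrow> nat" where
  "num_exunit_sums k f c n =
     card {x \<in> {1..k} \<rightarrow>\<^sub>E exunits f n. [(\<Sum>i = 1..k. x i) = c] (mod int n)}"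

end

theory Submission imports Defs begin

section \<open>Sums of periodic functions\<close>

text \<open>The gcd conditions make \<open>a1\<close> and \<open>b1\<close> units modulo
  \<open>n\<close>. With \<open>u\<close> and \<open>v\<close> representing a2/a1 and b2/b1, f(a) is
  a unit times (a - u)(a - v), and u - v is itself a unit. So a is an exunit iff, for every prime p
  dividing n, it avoids the two distinct residues u and v modulo p.

  The tuples are counted by convolution, one coordinate at a time
  (\<open>card_PiE_sum_cong_Suc\<close>). By the Chinese remainder theorem the indicator of the
  exunits is a product of functions of a mod p, and such products sum prime by prime, with a factor
  p^(e - 1) for e the multiplicity of p (\<open>sum_prod_periodic\<close>). After k coordinates the
  count is thus a product over p of p^((e - 1)(k - 1)) and a k-fold convolution modulo p.

  That local convolution is a coefficient of (S - T)^k in the group ring of the integers modulo p, S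
  being the sum of all elements and T = [u] + [v]. As S absorbs T up to a scalar, this is (-T)^k
  plus a multiple of S: the binomial sum comes from T^k, the terms (2 - p)^k - 2^k from S
  (\<open>avoid_count_Suc\<close>). Multiplying the condition on j by the unit
  \<open>a1 * b1\<close> gives the stated congruence.\<close>

lemma periodic_cong:
  fixes h :: "int \<Rightarrow> 'a"
  assumes "\<And>a. h (a mod m) = h a" "[a = b] (mod m)"
  shows "h a = h b"
  by (metis assms cong_def)

text \<open>Chinese remainder theorem: reduction modulo both moduli turns the sum over one period of
  the product into a double sum.\<close>

lemma sum_mult_periodic_coprime:
  fixes A B :: "int \<Rightarrow> 'a :: comm_semiring_1"
  assumes pos: "m > 0" "m' > 0" and cop: "coprime m m'"
    and A: "\<And>a. A (a mod m) = A a" and B: "\<And>a. B (a mod m') = B a"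
  shows "(\<Sum>a = 0..<m * m'. A a * B a) = (\<Sum>a = 0..<m. A a) * (\<Sum>a = 0..<m'. B a)"
proof -
  let ?g = "\<lambda>a. (a mod m, a mod m')"
  have inj: "inj_on ?g {0..<m * m'}"
  proof (rule inj_onI)
    fix x y assume xy: "x \<in> {0..<m * m'}" "y \<in> {0..<m * m'}" "?g x = ?g y"
    then have "[x = y] (mod m)" "[x = y] (mod m')"
      by (auto simp: cong_def)
    then have "[x = y] (mod m * m')"
      using cop by (simp add: coprime_cong_mult)
    then show "x = y"
      using xy by (simp add: cong_def)
  qed
  \<comment> \<open>Surjectivity by counting: the map is injective and both sides have m m'
    elements.\<close>
  have "?g ` {0..<m * m'} = {0..<m} \<times> {0..<m'}"
  proof (rule card_subset_eq)
    show "?g ` {0..<m * m'} \<subseteq> {0..<m} \<times> {0..<m'}"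
      using pos by auto
    show "card (?g ` {0..<m * m'}) = card ({0..<m} \<times> {0..<m'})"
      using pos by (simp add: card_image[OF inj] card_cartesian_product nat_mult_distrib)
  qed simp
  with inj have bij: "bij_betw ?g {0..<m * m'} ({0..<m} \<times> {0..<m'})"
    by (simp add: bij_betw_def)
  have "(\<Sum>a = 0..<m. A a) * (\<Sum>a = 0..<m'. B a)
      = (\<Sum>z \<in> {0..<m} \<times> {0..<m'}. A (fst z) * B (snd z))"
    by (simp add: sum_product sum.cartesian_product case_prod_unfold)
  also have "\<dots> = (\<Sum>a = 0..<m * m'. A (fst (?g a)) * B (snd (?g a)))"
    by (rule sum.reindex_bij_betw[OF bij, symmetric])
  finally show ?thesis
    by (simp add: A B)
qed

lemma sum_periodic_multiple:
  fixes h :: "int \<Rightarrow> 'a :: comm_semiring_1"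
  assumes per: "\<And>a. h (a mod m) = h a" and m: "m > 0"
  shows "(\<Sum>a = 0..<m * int l. h a) = of_nat l * (\<Sum>a = 0..<m. h a)"
proof (induction l)
  case (Suc l)
  have "{0..<m * int (Suc l)} = {0..<m * int l} \<union> {m * int l..<m * int l + m}"
    using m by (auto simp: algebra_simps) (smt (verit) mult_nonneg_nonneg of_nat_0_le_iff)
  moreover have "(\<Sum>a \<in> {m * int l..<m * int l + m}. h a) = (\<Sum>a = 0..<m. h a)"
  proof (rule sum.reindex_bij_witness[of _ "\<lambda>a. a + m * int l" "\<lambda>a. a - m * int l"])
    fix a assume "a \<in> {m * int l..<m * int l + m}"
    show "h (a - m * int l) = h a"
      by (rule periodic_cong[of h m]) (simp_all add: per cong_iff_dvd_diff)
  qed auto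
  ultimately show ?case
    by (simp add: sum.union_disjoint ivl_disj_int Suc algebra_simps)
qed simp

text \<open>The map r \<mapsto> (c - r) mod m is an involution on the residues.\<close>

lemma sum_periodic_reflect:
  fixes h :: "int \<Rightarrow> 'a :: comm_monoid_add"
  assumes per: "\<And>a. h (a mod m) = h a" and m: "m > 0"
  shows "(\<Sum>r = 0..<m. h (c - r)) = (\<Sum>r = 0..<m. h r)"
proof (rule sum.reindex_bij_witness[of _ "\<lambda>r. (c - r) mod m" "\<lambda>r. (c - r) mod m"])
  fix r assume "r \<in> {0..<m}"
  then show "(c - (c - r) mod m) mod m = r" "(c - (c - r) mod m) mod m = r"
    by (simp_all add: mod_diff_right_eq)
qed (use m per in auto)

text \<open>Pairing with the point mass at \<open>u\<close>; \<open>u\<close> need not be reduced,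
  since \<open>u mod m\<close> is its only representative in range.\<close>

lemma sum_periodic_delta:
  fixes h :: "int \<Rightarrow> 'a :: semiring_1"
  assumes per: "\<And>a. h (a mod m) = h a" and m: "m > 0"
  shows "(\<Sum>r = 0..<m. of_bool [r = u] (mod m) * h r) = h u"
proof -
  have "(\<Sum>r = 0..<m. of_bool [r = u] (mod m) * h r)
      = (\<Sum>r = 0..<m. if r = u mod m then h r else 0)"
    by (rule sum.cong) (auto simp: cong_def)
  also have "\<dots> = h u"
    using m per by simp
  finally show ?thesis .
qed

text \<open>The Chinese remainder theorem splits off one prime power at a time. Each factor depends
  on a modulo p only, so the sum over p^e consists of p^(e - 1) full periods.\<close>

lemma sum_prod_periodic_prime_powers:
  fixes h :: "nat \<Rightarrow> int \<Rightarrow> 'a :: comm_semiring_1"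
  assumes "finite P" "\<And>p. p \<in> P \<Longrightarrow> prime p" "\<And>p. p \<in> P \<Longrightarrow> e p > 0"
    and "\<And>p a. p \<in> P \<Longrightarrow> h p (a mod int p) = h p a"
  shows "(\<Sum>a = 0..<int (\<Prod>p\<in>P. p ^ e p). \<Prod>p\<in>P. h p a)
       = (\<Prod>p\<in>P. of_nat p ^ (e p - 1) * (\<Sum>r = 0..<int p. h p r))"
  using assms
proof (induction P rule: finite_induct)
  case empty
  have "{0..<1::int} = {0}" by auto
  then show ?case by simp
next
  case (insert p P)
  let ?M = "\<Prod>q\<in>P. q ^ e q"
  have p: "prime p" and ep: "e p > 0" and hp: "\<And>a. h p (a mod int p) = h p a"
    using insert.prems by auto
  have pe: "p ^ e p = p * p ^ (e p - 1)"
    using ep by (simp flip: power_Suc)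
  have cop: "coprime (p ^ e p) ?M"
    using insert.hyps insert.prems
    by (intro prod_coprime_right) (metis coprime_power_left_iff coprime_power_right_iff insertCI primes_coprime)
  have M: "?M > 0"
    using insert.prems by (intro prod_pos) (auto simp: prime_gt_0_nat)
  have hpe: "h p (a mod int (p ^ e p)) = h p a" for a
    by (rule periodic_cong[of "h p" "int p"])
      (simp_all add: hp cong_def pe mod_mod_cancel del: of_nat_power)
  have hM: "(\<Prod>q\<in>P. h q (a mod int ?M)) = (\<Prod>q\<in>P. h q a)" for a
  proof (rule prod.cong)
    fix q assume q: "q \<in> P"
    have "q dvd q ^ e q"
      using q insert.prems by simp
    also have "\<dots> dvd ?M"
      using q insert.hyps by (intro dvd_prodI) auto
    finally have "int q dvd int ?M"
      by (simp only: of_nat_dvd_iff)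
    then have "[a mod int ?M = a] (mod int q)"
      unfolding cong_def by (rule mod_mod_cancel)
    moreover have "h q (x mod int q) = h q x" for x
      using insert.prems(3) q by blast
    ultimately show "h q (a mod int ?M) = h q a"
      by (metis periodic_cong)
  qed simp
  have "(\<Sum>a = 0..<int (\<Prod>p\<in>insert p P. p ^ e p). \<Prod>p\<in>insert p P. h p a)
      = (\<Sum>a = 0..<int (p ^ e p) * int ?M. h p a * (\<Prod>q\<in>P. h q a))"
    using insert.hyps by simp
  also have "\<dots> = (\<Sum>a = 0..<int (p ^ e p). h p a) * (\<Sum>a = 0..<int ?M. \<Prod>q\<in>P. h q a)"
  proof (rule sum_mult_periodic_coprime)
    show "int (p ^ e p) > 0" "int ?M > 0" "coprime (int (p ^ e p)) (int ?M)"
      using p M cop by (simp_all only: of_nat_0_less_iff coprime_int_iff prime_gt_0_nat zero_less_power)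
  qed (fact hpe hM)+
  also have "(\<Sum>a = 0..<int (p ^ e p). h p a) = of_nat p ^ (e p - 1) * (\<Sum>r = 0..<int p. h p r)"
    using sum_periodic_multiple[of "h p" "int p" "p ^ (e p - 1)"] hp p
    unfolding pe of_nat_mult by (simp only: of_nat_power prime_gt_0_nat of_nat_0_less_iff)
  also have "(\<Sum>a = 0..<int ?M. \<Prod>q\<in>P. h q a)
      = (\<Prod>q\<in>P. of_nat q ^ (e q - 1) * (\<Sum>r = 0..<int q. h q r))"
    using insert.prems by (intro insert.IH) auto
  finally show ?case
    using insert.hyps by simp
qed

lemma sum_prod_periodic:
  fixes h :: "nat \<Rightarrow> int \<Rightarrow> 'a :: comm_semiring_1"
  assumes "n > 0" "\<And>p a. p \<in> prime_factors n \<Longrightarrow> h p (a mod int p) = h p a"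
  shows "(\<Sum>a = 0..<int n. \<Prod>p\<in>prime_factors n. h p a)
       = (\<Prod>p\<in>prime_factors n. of_nat p ^ (multiplicity p n - 1) * (\<Sum>r = 0..<int p. h p r))"
proof -
  have n: "(\<Prod>p\<in>prime_factors n. p ^ multiplicity p n) = n"
    using assms(1) by (rule prime_factorization_nat[symmetric])
  have "multiplicity p n > 0" if "p \<in> prime_factors n" for p
    using that by (simp add: prime_factors_multiplicity)
  then show ?thesis
    using sum_prod_periodic_prime_powers[of "prime_factors n" "\<lambda>p. multiplicity p n" h] assms(2)
    unfolding n by blast
qed

section \<open>Counting modulo a prime\<close>

text \<open>Pascal's rule, summed against a weight.\<close>

lemma sum_choose_Suc:
  fixes w :: "nat \<Rightarrow> 'a :: comm_semiring_1"
  shows "(\<Sum>j\<le>Suc k. of_nat (Suc k choose j) * w j)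
       = (\<Sum>j\<le>k. of_nat (k choose j) * w j) + (\<Sum>j\<le>k. of_nat (k choose j) * w (Suc j))"
proof -
  have "(\<Sum>j\<le>k. of_nat (k choose j) * w j) = (\<Sum>j\<le>Suc k. of_nat (k choose j) * w j)"
    by (simp add: binomial_eq_0)
  also have "\<dots> = w 0 + (\<Sum>j\<le>k. of_nat (k choose Suc j) * w (Suc j))"
    by (subst sum.atMost_Suc_shift) simp
  finally show ?thesis
    by (subst sum.atMost_Suc_shift) (simp add: sum.distrib algebra_simps)
qed

text \<open>The coefficient of [c] in ([u] + [v])^k in the group ring of the integers modulo
  \<open>m\<close>. It is rational because \<open>avoid_count\<close> divides by p.\<close>

definition binomial_fibre :: "int \<Rightarrow> int \<Rightarrow> int \<Rightarrow> nat \<Rightarrow> int \<Rightarrow> rat" where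
  "binomial_fibre m u v k c
     = (\<Sum>j\<le>k. of_nat (k choose j) * of_bool [int j * u + int (k - j) * v = c] (mod m))"

lemma binomial_fibre_periodic: "binomial_fibre m u v k (c mod m) = binomial_fibre m u v k c"
  by (simp add: binomial_fibre_def cong_def)

text \<open>Multiplication by one more factor [u] + [v].\<close>

lemma binomial_fibre_Suc:
  "binomial_fibre m u v (Suc k) c = binomial_fibre m u v k (c - u) + binomial_fibre m u v k (c - v)"
proof -
  \<comment> \<open>The bound on j keeps the truncated subtraction exact.\<close>
  have 1: "[int j * u + int (Suc k - j) * v = c] (mod m)
      \<longleftrightarrow> [int j * u + int (k - j) * v = c - v] (mod m)" if "j \<le> k" for j
    using that by (simp add: cong_iff_dvd_diff Suc_diff_le algebra_simps)
  have 2: "[int (Suc j) * u + int (Suc k - Suc j) * v = c] (mod m)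
      \<longleftrightarrow> [int j * u + int (k - j) * v = c - u] (mod m)" for j
    by (simp add: cong_iff_dvd_diff algebra_simps)
  have "(\<Sum>j\<le>k. of_nat (k choose j) * of_bool [int j * u + int (Suc k - j) * v = c] (mod m))
      = binomial_fibre m u v k (c - v)"
    unfolding binomial_fibre_def by (rule sum.cong) (simp_all only: 1 atMost_iff)
  then show ?thesis
    unfolding binomial_fibre_def sum_choose_Suc 2 by simp
qed

text \<open>The augmentation of T^k: each j meets exactly one residue c, so the whole binomial row
  is summed.\<close>

lemma sum_binomial_fibre:
  assumes "m > 0"
  shows "(\<Sum>c = 0..<m. binomial_fibre m u v k c) = 2 ^ k"
proof -
  have *: "(\<Sum>c = 0..<m. of_bool [w = c] (mod m)) = (1::rat)" for w
    using sum_periodic_delta[of "\<lambda>_. 1::rat" m w] assms unfolding cong_sym_eq[of w] by simp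
  have "(\<Sum>c = 0..<m. binomial_fibre m u v k c) = (\<Sum>j\<le>k. of_nat (k choose j))"
    unfolding binomial_fibre_def by (subst sum.swap) (simp add: * flip: sum_distrib_left)
  also have "\<dots> = of_nat (\<Sum>j\<le>k. k choose j)"
    by simp
  finally show ?thesis
    by (simp only: choose_row_sum) simp
qed

text \<open>If (S - T)^k = (-T)^k + \<lambda> S, then augmentation gives (p - 2)^k = (-2)^k +
  \<lambda> p; the terms outside the fibre are this \<lambda>.\<close>

definition avoid_count :: "nat \<Rightarrow> int \<Rightarrow> int \<Rightarrow> nat \<Rightarrow> int \<Rightarrow> rat" where
  "avoid_count p u v k c
     = (-1) ^ k / of_nat p * (of_nat p * binomial_fibre (int p) u v k c + (2 - of_nat p) ^ k - 2 ^ k)"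

definition avoids :: "nat \<Rightarrow> int \<Rightarrow> int \<Rightarrow> int \<Rightarrow> rat" where
  "avoids p u v a = of_bool (\<not> [a = u] (mod int p) \<and> \<not> [a = v] (mod int p))"

lemma avoids_periodic: "avoids p u v (a mod int p) = avoids p u v a"
  by (simp add: avoids_def cong_def)

lemma avoid_count_periodic: "avoid_count p u v k (c mod int p) = avoid_count p u v k c"
  by (simp add: avoid_count_def binomial_fibre_periodic)

text \<open>The coefficients of S - T; as \<open>u\<close> and \<open>v\<close> differ modulo p, no
  residue is subtracted twice.\<close>

lemma avoids_eq:
  assumes "\<not> [u = v] (mod int p)"
  shows "avoids p u v a = 1 - of_bool [a = u] (mod int p) - of_bool [a = v] (mod int p)"
  using assms by (auto simp: avoids_def cong_def)

text \<open>In the group ring of the integers modulo \<open>p\<close>, let \<open>S\<close> be the sum of all elements and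
  \<open>T = [u] + [v]\<close>. Since \<open>S T = 2 S\<close> and \<open>S\<^sup>2 = p S\<close>, the power \<open>(S - T)\<^sup>k\<close> is \<open>(-T)\<^sup>k\<close> plus
  a multiple of \<open>S\<close>, which the augmentation determines; \<^const>\<open>avoid_count\<close> is its coefficient
  at \<open>c\<close>.\<close>

lemma avoid_count_Suc:
  assumes p: "p > 0" and uv: "\<not> [u = v] (mod int p)"
  shows "(\<Sum>r = 0..<int p. avoids p u v r * avoid_count p u v k (c - r)) = avoid_count p u v (Suc k) c"
proof -
  let ?F = "avoid_count p u v k"
  have per: "?F (c - a mod int p) = ?F (c - a)" for a
    by (metis avoid_count_periodic mod_diff_right_eq)
  have "(\<Sum>r = 0..<int p. avoids p u v r * ?F (c - r))
      = (\<Sum>r = 0..<int p. ?F (c - r)) - (\<Sum>r = 0..<int p. of_bool [r = u] (mod int p) * ?F (c - r))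
        - (\<Sum>r = 0..<int p. of_bool [r = v] (mod int p) * ?F (c - r))"
    unfolding avoids_eq[OF uv] by (simp only: left_diff_distrib sum_subtractf mult_1)
  also have "\<dots> = (\<Sum>r = 0..<int p. ?F (c - r)) - ?F (c - u) - ?F (c - v)"
    using sum_periodic_delta[of "\<lambda>r. ?F (c - r)" "int p"] per p by simp
  also have "(\<Sum>r = 0..<int p. ?F (c - r)) = (\<Sum>r = 0..<int p. ?F r)"
    using p by (intro sum_periodic_reflect) (auto simp: avoid_count_periodic)
  \<comment> \<open>The augmentation of (S - T)^k, as T^k contributes 2^k and cancels the term
    -2^k.\<close>
  also have "\<dots> = (-1) ^ k * (2 - of_nat p) ^ k"
  proof -
    have "(\<Sum>r = 0..<int p. ?F r) = (-1) ^ k / of_nat p *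
        (of_nat p * (\<Sum>r = 0..<int p. binomial_fibre (int p) u v k r)
         + of_nat p * ((2 - of_nat p) ^ k - 2 ^ k))"
      unfolding avoid_count_def
      by (simp add: sum.distrib sum_subtractf algebra_simps flip: sum_distrib_left)
    then show ?thesis
      using p by (simp add: sum_binomial_fibre field_simps)
  qed
  \<comment> \<open>The recurrence closes because 2 (2 - p)^k - p (2 - p)^k = (2 - p)^(k +
    1).\<close>
  also have "(-1) ^ k * (2 - of_nat p) ^ k - ?F (c - u) - ?F (c - v) = avoid_count p u v (Suc k) c"
    using p by (simp add: avoid_count_def binomial_fibre_Suc field_simps)
  finally show ?thesis .
qed

lemma avoid_count_1:
  assumes p: "p > 0" and uv: "\<not> [u = v] (mod int p)"
  shows "avoid_count p u v (Suc 0) c = avoids p u v c"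
  using p unfolding avoids_eq[OF uv] avoid_count_def binomial_fibre_def
  by (simp add: field_simps cong_sym_eq)

section \<open>Counting tuples\<close>

text \<open>Tuples on \<open>{1..Suc k}\<close> correspond to pairs of a last entry and a shorter
  tuple, via function update at \<open>Suc k\<close>.\<close>

lemma card_PiE_sum_cong_Suc:
  fixes E :: "int set"
  assumes "finite E"
  shows "card {x \<in> {1..Suc k} \<rightarrow>\<^sub>E E. [(\<Sum>i = 1..Suc k. x i) = c] (mod m)}
       = (\<Sum>a\<in>E. card {x \<in> {1..k} \<rightarrow>\<^sub>E E. [(\<Sum>i = 1..k. x i) = c - a] (mod m)})"
proof -
  let ?X = "\<lambda>k. {1..k::nat} \<rightarrow>\<^sub>E E"
  have fin: "finite (?X k)" for k
    using assms by (simp add: finite_PiE)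
  have card_eq: "card {x \<in> ?X k. Q x} = (\<Sum>x\<in>?X k. of_bool (Q x))" for k Q
    using fin[of k] by (simp add: Int_def)
  have ins: "{1..Suc k} = insert (Suc k) {1..k}"
    by auto
  have inj: "inj_on (\<lambda>(y, g). g(Suc k := y)) (E \<times> ?X k)"
    by (rule inj_combinator) simp
  have upd: "[(\<Sum>i = 1..Suc k. (g(Suc k := y)) i) = c] (mod m)
      \<longleftrightarrow> [(\<Sum>i = 1..k. g i) = c - y] (mod m)" for y and g :: "nat \<Rightarrow> int"
    by (simp add: cong_iff_dvd_diff algebra_simps)
  have "(\<Sum>x\<in>?X (Suc k). of_bool [(\<Sum>i = 1..Suc k. x i) = c] (mod m))
      = (\<Sum>(y, g)\<in>E \<times> ?X k. of_bool [(\<Sum>i = 1..Suc k. (g(Suc k := y)) i) = c] (mod m) :: nat)"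
    unfolding ins PiE_insert_eq
    by (subst sum.reindex[OF inj]) (simp add: case_prod_unfold flip: ins)
  also have "\<dots> = (\<Sum>y\<in>E. \<Sum>g\<in>?X k. of_bool [(\<Sum>i = 1..k. g i) = c - y] (mod m))"
    unfolding upd by (rule sum.cartesian_product[symmetric])
  finally show ?thesis
    unfolding card_eq .
qed

lemma prod_of_bool:
  assumes "finite A"
  shows "(\<Prod>x\<in>A. of_bool (P x)) = (of_bool (\<forall>x\<in>A. P x) :: 'a :: comm_semiring_1)"
  using assms by (induction rule: finite_induct) auto

text \<open>Each coordinate after the first is one convolution, which costs p^(multiplicity - 1) at
  every p. The induction starts with one coordinate: the empty tuple would require c to vanish
  modulo \<open>n\<close>, a condition that residues modulo the primes alone do not detect.\<close>

lemma card_sum_avoiding: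
  fixes n :: nat and u v :: int
  assumes n: "n > 0" and uv: "coprime (u - v) (int n)"
  defines "E \<equiv> {a \<in> {0..<int n}. coprime ((a - u) * (a - v)) (int n)}"
  shows "rat_of_nat (card {x \<in> {1..Suc k} \<rightarrow>\<^sub>E E. [(\<Sum>i = 1..Suc k. x i) = c] (mod int n)})
       = (\<Prod>p\<in>prime_factors n. of_nat p ^ ((multiplicity p n - 1) * k) * avoid_count p u v (Suc k) c)"
proof -
  have cop: "coprime b (int n) \<longleftrightarrow> (\<forall>p\<in>prime_factors n. \<not> int p dvd b)" for b
  proof
    assume b: "coprime b (int n)"
    show "\<forall>p\<in>prime_factors n. \<not> int p dvd b"
    proof
      fix p assume "p \<in> prime_factors n"
      then have "prime p" "int p dvd int n"
        by auto
      then show "\<not> int p dvd b"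
        using b by (metis coprime_common_divisor not_prime_unit prime_nat_int_transfer)
    qed
  next
    assume b: "\<forall>p\<in>prime_factors n. \<not> int p dvd b"
    show "coprime b (int n)"
    proof (rule ccontr)
      assume "\<not> coprime b (int n)"
      then obtain d where d: "d dvd b" "d dvd int n" "\<not> is_unit d"
        by (rule not_coprimeE)
      moreover from d(2) n have "d \<noteq> 0"
        by auto
      ultimately obtain q where q: "prime q" "q dvd d"
        using prime_divisor_exists by blast
      define p where "p = nat q"
      have qp: "q = int p"
        using q(1) by (simp add: p_def prime_ge_0_int)
      have "p \<in> prime_factors n"
        using q d(2) n dvd_trans[OF q(2) d(2)] by (simp add: qp in_prime_factors_iff)
      then show False
        using b dvd_trans[OF q(2) d(1)] by (simp add: qp)
    qed
  qed
  have p0: "p > 0" and puv: "\<not> [u = v] (mod int p)" if "p \<in> prime_factors n" for p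
    using that uv unfolding cop cong_iff_dvd_diff by (simp_all add: in_prime_factors_iff prime_gt_0_nat)
  have fin: "finite E"
    unfolding E_def by (rule finite_subset[of _ "{0..<int n}"]) auto
  have sumE: "(\<Sum>a\<in>E. g a) = (\<Sum>a = 0..<int n. of_bool (coprime ((a - u) * (a - v)) (int n)) * g a)"
    for g :: "int \<Rightarrow> rat"
    unfolding E_def by (rule sum.mono_neutral_cong_left) auto
  \<comment> \<open>The indicator of \<open>E\<close> factors over the primes, each factor depending
    only on a mod p.\<close>
  have ind: "of_bool (coprime ((a - u) * (a - v)) (int n)) = (\<Prod>p\<in>prime_factors n. avoids p u v a)" for a
  proof -
    have "coprime ((a - u) * (a - v)) (int n) \<longleftrightarrow>
        (\<forall>p\<in>prime_factors n. \<not> [a = u] (mod int p) \<and> \<not> [a = v] (mod int p))"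
      unfolding coprime_mult_left_iff unfolding cop cong_iff_dvd_diff by blast
    then show ?thesis
      by (simp add: avoids_def prod_of_bool)
  qed
  show ?thesis
  proof (induction k arbitrary: c)
    case 0
    let ?h = "\<lambda>a. rat_of_nat (of_bool (coprime ((a - u) * (a - v)) (int n)))"
    have h: "?h a = (\<Prod>p\<in>prime_factors n. avoids p u v a)" for a
      by (simp only: ind of_nat_of_bool)
    \<comment> \<open>Periodicity modulo \<open>n\<close> allows evaluation at an unreduced
      c.\<close>
    have per: "?h (a mod int n) = ?h a" for a
      unfolding h
    proof (intro prod.cong refl)
      fix p assume "p \<in> prime_factors n"
      then have "int p dvd int n"
        by auto
      then have "[a mod int n = a] (mod int p)"
        unfolding cong_def by (rule mod_mod_cancel)
      then show "avoids p u v (a mod int n) = avoids p u v a"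
        by (rule periodic_cong[of "avoids p u v", OF avoids_periodic])
    qed
    have "card {x \<in> {1..Suc 0} \<rightarrow>\<^sub>E E. [(\<Sum>i = 1..Suc 0. x i) = c] (mod int n)}
        = (\<Sum>a\<in>E. of_bool [a = c] (mod int n))"
      unfolding card_PiE_sum_cong_Suc[OF fin]
      by (rule sum.cong) (auto simp: cong_iff_dvd_diff dvd_diff_commute)
    also have "rat_of_nat \<dots> = (\<Sum>a = 0..<int n. of_bool [a = c] (mod int n) * ?h a)"
      unfolding of_nat_sum sumE by (simp only: of_nat_of_bool mult.commute)
    also have "\<dots> = ?h c"
      using n by (intro sum_periodic_delta per) simp
    finally show ?case
      unfolding h using avoid_count_1 p0 puv by simp
  next
    case (Suc k)
    \<comment> \<open>By induction the shorter count is a product of functions of c mod p, so the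
      convolution again splits over the primes.\<close>
    let ?G = "\<lambda>p c. of_nat p ^ ((multiplicity p n - 1) * k) * avoid_count p u v (Suc k) c"
    have per: "avoid_count p u v (Suc k) (c - a mod int p) = avoid_count p u v (Suc k) (c - a)" for a p
      by (metis avoid_count_periodic mod_diff_right_eq)
    have "rat_of_nat (card {x \<in> {1..Suc (Suc k)} \<rightarrow>\<^sub>E E. [(\<Sum>i = 1..Suc (Suc k). x i) = c] (mod int n)})
        = (\<Sum>a\<in>E. \<Prod>p\<in>prime_factors n. ?G p (c - a))"
      unfolding card_PiE_sum_cong_Suc[OF fin, of "Suc k"] of_nat_sum Suc.IH ..
    also have "\<dots> = (\<Sum>a = 0..<int n. of_bool (coprime ((a - u) * (a - v)) (int n))
        * (\<Prod>p\<in>prime_factors n. ?G p (c - a)))"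
      by (rule sumE)
    also have "\<dots> = (\<Sum>a = 0..<int n. \<Prod>p\<in>prime_factors n. avoids p u v a * ?G p (c - a))"
      unfolding ind prod.distrib ..
    also have "\<dots> = (\<Prod>p\<in>prime_factors n. of_nat p ^ (multiplicity p n - 1)
        * (\<Sum>r = 0..<int p. avoids p u v r * ?G p (c - r)))"
      using n by (intro sum_prod_periodic) (simp_all add: avoids_periodic per)
    also have "\<dots> = (\<Prod>p\<in>prime_factors n. of_nat p ^ ((multiplicity p n - 1) * Suc k)
        * avoid_count p u v (Suc (Suc k)) c)"
    proof (rule prod.cong)
      fix p assume p: "p \<in> prime_factors n"
      have "(\<Sum>r = 0..<int p. avoids p u v r * ?G p (c - r))
          = of_nat p ^ ((multiplicity p n - 1) * k) * avoid_count p u v (Suc (Suc k)) c"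
        unfolding avoid_count_Suc[OF p0[OF p] puv[OF p], symmetric] sum_distrib_left
        by (simp add: mult_ac)
      then show "of_nat p ^ (multiplicity p n - 1) * (\<Sum>r = 0..<int p. avoids p u v r * ?G p (c - r))
          = of_nat p ^ ((multiplicity p n - 1) * Suc k) * avoid_count p u v (Suc (Suc k)) c"
        by (simp add: power_add)
    qed simp
    finally show ?case .
  qed
qed

section \<open>Reduction of the quadratic to its roots modulo \<open>n\<close>\<close>

theorem theorem1p3:
  fixes k n :: nat and c a1 a2 b1 b2 :: int and f :: "int poly"
  assumes "k \<ge> 2" and "n \<ge> 1"
    and "f = [:- a2, a1:] * [:- b2, b1:]"
    and "gcd a1 (int n) = 1" and "gcd b1 (int n) = 1"
    and "gcd (a1 * b2 - a2 * b1) (int n) = 1"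
  shows "(of_nat (num_exunit_sums k f c n) :: rat) =
    (- 1) ^ (k * card (prime_factors n)) *
    (\<Prod>p \<in> prime_factors n.
       of_nat p powi (int k * int (multiplicity p n) - int (multiplicity p n) - int k) *
       (of_nat p * (\<Sum>j \<in> {j \<in> {0..k}. [(a2 * b1 - a1 * b2) * int j
                                   = a1 * b1 * c - a1 * b2 * int k] (mod int p)}.
                      of_nat (k choose j))
        + (2 - of_nat p) ^ k - 2 ^ k))"
proof -
  have ca: "coprime a1 (int n)" and cb: "coprime b1 (int n)"
    and cd: "coprime (a1 * b2 - a2 * b1) (int n)"
    using assms by (simp_all add: coprime_iff_gcd_eq_1)
  obtain s t where s: "[a1 * s = 1] (mod int n)" and t: "[b1 * t = 1] (mod int n)"
    using cong_solve_coprime_int[OF ca] cong_solve_coprime_int[OF cb] by auto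
  \<comment> \<open>Integer representatives of the roots a2/a1 and b2/b1 modulo
    \<open>n\<close>.\<close>
  define u v where "u = s * a2" and "v = t * b2"
  have u: "[a1 * u = a2] (mod int n)" and v: "[b1 * v = b2] (mod int n)"
    using cong_scalar_right[OF s, of a2] cong_scalar_right[OF t, of b2]
    by (simp_all add: u_def v_def mult.assoc)
  have uv: "coprime (u - v) (int n)"
  proof -
    \<comment> \<open>Up to the unit \<open>a1 * b1\<close>, the difference of the roots is the
      given determinant.\<close>
    have "[a1 * (b1 * v) - b1 * (a1 * u) = a1 * b2 - b1 * a2] (mod int n)"
      by (intro cong_diff cong_scalar_left u v)
    then have "[a1 * b1 * (v - u) = a1 * b2 - a2 * b1] (mod int n)"
      by (simp add: algebra_simps)
    then have "coprime (a1 * b1 * (v - u)) (int n)"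
      using cd cong_imp_coprime cong_sym by blast
    then have "coprime (- (v - u)) (int n)"
      unfolding coprime_minus_left_iff by simp
    then show ?thesis
      by simp
  qed
  have E: "exunits f n = {a \<in> {0..<int n}. coprime ((a - u) * (a - v)) (int n)}"
  proof -
    have "coprime (poly f a) (int n) \<longleftrightarrow> coprime ((a - u) * (a - v)) (int n)" for a
    proof -
      have "[(a1 * a - a1 * u) * (b1 * a - b1 * v) = (a1 * a - a2) * (b1 * a - b2)] (mod int n)"
        by (intro cong_mult cong_diff cong_refl u v)
      then have "[a1 * b1 * ((a - u) * (a - v)) = poly f a] (mod int n)"
        by (simp add: assms(3) algebra_simps)
      then have "coprime (poly f a) (int n) \<longleftrightarrow> coprime (a1 * b1 * ((a - u) * (a - v))) (int n)"
        using cong_imp_coprime cong_sym by blast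
      then show ?thesis
        using ca cb by simp
    qed
    then show ?thesis
      unfolding exunits_def by (simp add: coprime_iff_gcd_eq_1)
  qed
  obtain l where l: "k = Suc l"
    using assms(1) by (cases k) auto
  have fibre: "(\<Sum>j \<in> {j \<in> {0..k}. [(a2 * b1 - a1 * b2) * int j
        = a1 * b1 * c - a1 * b2 * int k] (mod int p)}. of_nat (k choose j))
      = binomial_fibre (int p) u v k c" if p: "p \<in> prime_factors n" for p
  proof -
    have "int p dvd int n"
      using p by auto
    then have up: "[a1 * u = a2] (mod int p)" and vp: "[b1 * v = b2] (mod int p)"
      and ap: "coprime (a1 * b1) (int p)"
      using u v ca cb by (auto intro: cong_dvd_modulus coprime_divisors[OF dvd_refl])
    have "[(a2 * b1 - a1 * b2) * int j = a1 * b1 * c - a1 * b2 * int k] (mod int p)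
        \<longleftrightarrow> [int j * u + int (k - j) * v = c] (mod int p)" if "j \<le> k" for j
    proof -
      \<comment> \<open>Scaling j u + (k - j) v by the unit \<open>a1 * b1\<close> clears the
        denominators of both roots.\<close>
      have "[b1 * int j * (a1 * u) + a1 * int (k - j) * (b1 * v)
          = b1 * int j * a2 + a1 * int (k - j) * b2] (mod int p)"
        by (intro cong_add cong_scalar_left up vp)
      then have *: "[a1 * b1 * (int j * u + int (k - j) * v)
          = b1 * int j * a2 + a1 * int (k - j) * b2] (mod int p)"
        by (simp add: algebra_simps)
      have "[(a2 * b1 - a1 * b2) * int j = a1 * b1 * c - a1 * b2 * int k] (mod int p)
          \<longleftrightarrow> [b1 * int j * a2 + a1 * int (k - j) * b2 = a1 * b1 * c] (mod int p)"
        using that by (simp add: cong_iff_dvd_diff of_nat_diff algebra_simps)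
      also have "\<dots> \<longleftrightarrow> [a1 * b1 * (int j * u + int (k - j) * v) = a1 * b1 * c] (mod int p)"
        using * cong_sym cong_trans by blast
      also have "\<dots> \<longleftrightarrow> [int j * u + int (k - j) * v = c] (mod int p)"
        using ap by (rule cong_mult_lcancel)
      finally show ?thesis .
    qed
    then have eq: "{j \<in> {0..k}. [(a2 * b1 - a1 * b2) * int j
        = a1 * b1 * c - a1 * b2 * int k] (mod int p)}
        = {..k} \<inter> {j. [int j * u + int (k - j) * v = c] (mod int p)}"
      unfolding atLeast0AtMost by blast
    show ?thesis
      unfolding binomial_fibre_def eq by (simp only: sum_mult_of_bool_eq finite_atMost)
  qed
  have "rat_of_nat (num_exunit_sums k f c n)
      = (\<Prod>p\<in>prime_factors n. of_nat p ^ ((multiplicity p n - 1) * l) * avoid_count p u v k c)"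
    unfolding num_exunit_sums_def E l using assms(2) uv by (intro card_sum_avoiding) simp_all
  also have "\<dots> = (\<Prod>p\<in>prime_factors n. (-1) ^ k *
      (of_nat p powi (int k * int (multiplicity p n) - int (multiplicity p n) - int k) *
       (of_nat p * binomial_fibre (int p) u v k c + (2 - of_nat p) ^ k - 2 ^ k)))"
  proof (rule prod.cong)
    fix p assume p: "p \<in> prime_factors n"
    then have p0: "rat_of_nat p \<noteq> 0" and "multiplicity p n > 0"
      by (auto simp: prime_factors_multiplicity prime_gt_0_nat)
    \<comment> \<open>The exponent is (e - 1)(k - 1) - 1, the last -1 being the division by p in
      \<open>avoid_count\<close>. It equals -1 when e = 1, hence \<open>powi\<close>.\<close>
    then have "int k * int (multiplicity p n) - int (multiplicity p n) - int k
        = int ((multiplicity p n - 1) * l) - 1"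
      by (simp add: l of_nat_diff algebra_simps)
    then have "rat_of_nat p powi (int k * int (multiplicity p n) - int (multiplicity p n) - int k)
        = of_nat p ^ ((multiplicity p n - 1) * l) / of_nat p"
      using p0 by (simp only: power_int_diff power_int_of_nat power_int_1_right simp_thms)
    then show "of_nat p ^ ((multiplicity p n - 1) * l) * avoid_count p u v k c = (-1) ^ k *
      (of_nat p powi (int k * int (multiplicity p n) - int (multiplicity p n) - int k) *
       (of_nat p * binomial_fibre (int p) u v k c + (2 - of_nat p) ^ k - 2 ^ k))"
      by (simp add: avoid_count_def)
  qed simp
  \<comment> \<open>One sign (-1)^k is collected from each prime divisor.\<close>
  also have "\<dots> = (- 1) ^ (k * card (prime_factors n)) * (\<Prod>p\<in>prime_factors n.
      of_nat p powi (int k * int (multiplicity p n) - int (multiplicity p n) - int k) *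
       (of_nat p * binomial_fibre (int p) u v k c + (2 - of_nat p) ^ k - 2 ^ k))"
    by (simp add: prod.distrib power_mult)
  finally show ?thesis
    using fibre by simp
qed

end
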